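(* Let $\mathcal{G}$ be a compact simple Lie algebra and, for primitive cocycles of $\mathcal{G}$ of orders $2m-1$ and $2l-1$, let $t^{(m)}$, $t^{(l)}$ be the associated symmetric invariant tensors $$t^{i_1\dots i_m}=[\Omega^{(2m-1)}]^{j_1\dots j_{2m-2}i_m}\,C^{i_1}_{j_1j_2}\cdots C^{i_{m-1}}_{j_{2m-3}j_{2m-2}}$$ (and likewise for $l$). Then $$t^{i_1\dots i_l i_{l+1}\dots i_m}\,t_{i_1\dots i_l}=0\qquad\text{for all } l<m .$$
   Context: $\mathcal{G}$ is a compact simple real Lie algebra with basis $\{X_i\}_{i=1}^r$, $[X_i,X_j]=C_{ij}^kX_k$; repeated indices are summed. The basis is chosen so that the Killing form is a negative multiple of $\delta_{ij}$, so indices are raised and lowered with $\delta_{ij}$ and $C_{ijk}$ is totally antisymmetric. In this statement $l$ denotes an order of a tensor, not the rank; $t^{i_1\dots i_m}$ are the coordinates of $t^{(m)}$ and $t_{i_1\dots i_l}$ those of $t^{(l)}$. A tensor $h_{i_1\dots i_m}$ is invariant if $\sum_{s=1}^m C^\rho_{\nu i_s} h_{i_1\dots i_{s-1}\rho i_{s+1}\dots i_m}=0$ for all $\nu,i_1,\dots,i_m$. A symmetric invariant tensor of order $m$ is primitive if it is not a linear combination of symmetrised products of symmetric invariant tensors of lower order. The generalized $\epsilon$ symbol is $\epsilon_{\alpha_1\dots\alpha_n}^{\beta_1\dots\beta_n}=\sum_{\sigma\in S_n}\mathrm{sgn}(\sigma)\,\delta_{\alpha_1}^{\beta_{\sigma(1)}}\cdots\delta_{\alpha_n}^{\beta_{\sigma(n)}}$.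 A primitive $(2m-1)$-cocycle is the skewsymmetric invariant tensor constructed from a primitive symmetric invariant tensor $h$ of order $m$ by $$\Omega^{(2m-1)}_{i_1\dots i_{2m-2}\sigma}=\frac{1}{(2m-1)!}\,\epsilon^{j_1\dots j_{2m-2}\rho}_{i_1\dots i_{2m-2}\sigma}\,C_{j_1j_2}^{l_1}\cdots C_{j_{2m-3}j_{2m-2}}^{l_{m-1}}\,h_{l_1\dots l_{m-1}\rho}.$$ *)

theory Defs
  imports "HOL-Analysis.Analysis" "HOL-Combinatorics.Permutations"
begin

section \<open>Compact simple real Lie algebras\<close>

definition lie_bracket :: "('g::real_vector \<Rightarrow> 'g \<Rightarrow> 'g) \<Rightarrow> bool" where
  "lie_bracket br \<longleftrightarrow> bilinear br \<and> (\<forall>x. br x x = 0) \<and>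
     (\<forall>x y z. br x (br y z) + br y (br z x) + br z (br x y) = 0)"

definition lie_ideal :: "('g::real_vector \<Rightarrow> 'g \<Rightarrow> 'g) \<Rightarrow> 'g set \<Rightarrow> bool" where
  "lie_ideal br I \<longleftrightarrow> subspace I \<and> (\<forall>x. \<forall>y\<in>I. br x y \<in> I)"

definition simple_lie_algebra :: "('g::real_vector \<Rightarrow> 'g \<Rightarrow> 'g) \<Rightarrow> bool" where
  "simple_lie_algebra br \<longleftrightarrow> lie_bracket br \<and> (\<exists>x y. br x y \<noteq> 0) \<and>
     (\<forall>I. lie_ideal br I \<longrightarrow> I = {0} \<or> I = UNIV)"

definition indexed_basis :: "('n::finite \<Rightarrow> 'g::real_vector) \<Rightarrow> bool" where
  "indexed_basis X \<longleftrightarrow> inj X \<and> independent (range X) \<and> span (range X) = UNIV"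

definition coord :: "('n \<Rightarrow> 'g::real_vector) \<Rightarrow> 'g \<Rightarrow> 'n \<Rightarrow> real" where
  "coord X v k = representation (range X) v (X k)"

text \<open>The Killing form \<open>tr (ad x \<circ> ad y)\<close>; the trace is evaluated in the basis \<open>X\<close>,
  and its value does not depend on which basis is used.\<close>

definition killing :: "('g::real_vector \<Rightarrow> 'g \<Rightarrow> 'g) \<Rightarrow> ('n::finite \<Rightarrow> 'g) \<Rightarrow> 'g \<Rightarrow> 'g \<Rightarrow> real" where
  "killing br X x y = (\<Sum>k\<in>UNIV. coord X (br x (br y (X k))) k)"

text \<open>A simple real Lie algebra is compact iff its Killing form is negative definite.\<close>

definition compact_simple_lie_algebra ::
    "('g::real_vector \<Rightarrow> 'g \<Rightarrow> 'g) \<Rightarrow> ('n::finite \<Rightarrow> 'g) \<Rightarrow> bool" where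
  "compact_simple_lie_algebra br X \<longleftrightarrow>
     simple_lie_algebra br \<and> indexed_basis X \<and> (\<forall>x. x \<noteq> 0 \<longrightarrow> killing br X x x < 0)"

definition killing_orthogonal ::
    "('g::real_vector \<Rightarrow> 'g \<Rightarrow> 'g) \<Rightarrow> ('n::finite \<Rightarrow> 'g) \<Rightarrow> bool" where
  "killing_orthogonal br X \<longleftrightarrow>
     (\<exists>c>0. \<forall>i j. killing br X (X i) (X j) = - c * (if i = j then 1 else 0))"

text \<open>\<open>struct_const br X i j k\<close> is $C_{ij}^k$. With a basis as above, indices are raised and
  lowered with $\delta_{ij}$, so that upper and lower positions are not distinguished below.\<close>

definition struct_const ::
    "('g::real_vector \<Rightarrow> 'g \<Rightarrow> 'g) \<Rightarrow> ('n \<Rightarrow> 'g) \<Rightarrow> 'n \<Rightarrow> 'n \<Rightarrow> 'n \<Rightarrow> real" where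
  "struct_const br X i j k = coord X (br (X i) (X j)) k"


section \<open>Tensors in coordinates\<close>

text \<open>A tensor of order \<open>m\<close> is given by its coordinates, a real function of the list of its
  \<open>m\<close> indices; values on lists of any other length are irrelevant. List positions count from 0.\<close>

type_synonym 'n tensor = "'n list \<Rightarrow> real"

definition idx :: "nat \<Rightarrow> 'n list set" where
  "idx m = {is. length is = m}"

definition symmetric_tensor :: "nat \<Rightarrow> 'n tensor \<Rightarrow> bool" where
  "symmetric_tensor m h \<longleftrightarrow>
     (\<forall>\<sigma>. \<sigma> permutes {..<m} \<longrightarrow> (\<forall>is\<in>idx m. h (permute_list \<sigma> is) = h is))"

definition invariant_tensor ::
    "('n::finite \<Rightarrow> 'n \<Rightarrow> 'n \<Rightarrow> real) \<Rightarrow> nat \<Rightarrow> 'n tensor \<Rightarrow> bool" where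
  "invariant_tensor C m h \<longleftrightarrow>
     (\<forall>\<nu>. \<forall>is\<in>idx m. (\<Sum>s<m. \<Sum>\<rho>\<in>UNIV. C \<nu> (is ! s) \<rho> * h (is[s := \<rho>])) = 0)"

text \<open>The tensor product of a list of tensors, each given together with its order.\<close>

fun tensor_prod :: "(nat \<times> 'n tensor) list \<Rightarrow> 'n tensor" where
  "tensor_prod [] is = 1"
| "tensor_prod ((p, a) # fs) is = a (take p is) * tensor_prod fs (drop p is)"

definition symmetrise :: "nat \<Rightarrow> 'n tensor \<Rightarrow> 'n tensor" where
  "symmetrise m h is = (1 / fact m) * (\<Sum>\<sigma> | \<sigma> permutes {..<m}. h (permute_list \<sigma> is))"

definition lower_order_factors ::
    "('n::finite \<Rightarrow> 'n \<Rightarrow> 'n \<Rightarrow> real) \<Rightarrow> nat \<Rightarrow> (nat \<times> 'n tensor) list \<Rightarrow> bool" where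
  "lower_order_factors C m fs \<longleftrightarrow> sum_list (map fst fs) = m \<and>
     (\<forall>(p, a)\<in>set fs. p < m \<and> symmetric_tensor p a \<and> invariant_tensor C p a)"

definition decomposable_tensor ::
    "('n::finite \<Rightarrow> 'n \<Rightarrow> 'n \<Rightarrow> real) \<Rightarrow> nat \<Rightarrow> 'n tensor \<Rightarrow> bool" where
  "decomposable_tensor C m h \<longleftrightarrow>
     (\<exists>(N::nat) (c :: nat \<Rightarrow> real) fs. (\<forall>a<N. lower_order_factors C m (fs a)) \<and>
        (\<forall>is\<in>idx m. h is = (\<Sum>a<N. c a * symmetrise m (tensor_prod (fs a)) is)))"

definition primitive_tensor ::
    "('n::finite \<Rightarrow> 'n \<Rightarrow> 'n \<Rightarrow> real) \<Rightarrow> nat \<Rightarrow> 'n tensor \<Rightarrow> bool" where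
  "primitive_tensor C m h \<longleftrightarrow>
     symmetric_tensor m h \<and> invariant_tensor C m h \<and> \<not> decomposable_tensor C m h"


section \<open>Cocycles and their associated symmetric tensors\<close>

text \<open>\<open>gen_eps n \<alpha> \<beta>\<close> has lower indices \<open>\<alpha>\<close> and upper indices \<open>\<beta>\<close>.\<close>

definition gen_eps :: "nat \<Rightarrow> 'n list \<Rightarrow> 'n list \<Rightarrow> real" where
  "gen_eps n \<alpha> \<beta> = (\<Sum>\<sigma> | \<sigma> permutes {..<n}.
     of_int (sign \<sigma>) * (\<Prod>k<n. if \<alpha> ! k = \<beta> ! (\<sigma> k) then 1 else 0))"

text \<open>The product $C_{j_1j_2}^{l_1}\cdots C_{j_{2q-1}j_{2q}}^{l_q}$.\<close>

definition struct_prod :: "('n \<Rightarrow> 'n \<Rightarrow> 'n \<Rightarrow> real) \<Rightarrow> nat \<Rightarrow> 'n list \<Rightarrow> 'n list \<Rightarrow> real" where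
  "struct_prod C q js ls = (\<Prod>s<q. C (js ! (2 * s)) (js ! (2 * s + 1)) (ls ! s))"

definition cocycle_of ::
    "('n::finite \<Rightarrow> 'n \<Rightarrow> 'n \<Rightarrow> real) \<Rightarrow> nat \<Rightarrow> 'n tensor \<Rightarrow> 'n tensor" where
  "cocycle_of C m h is = (1 / fact (2 * m - 1)) *
     (\<Sum>js\<in>idx (2 * m - 2). \<Sum>\<rho>\<in>UNIV. \<Sum>ls\<in>idx (m - 1).
        gen_eps (2 * m - 1) is (js @ [\<rho>]) * struct_prod C (m - 1) js ls * h (ls @ [\<rho>]))"

definition primitive_cocycle ::
    "('n::finite \<Rightarrow> 'n \<Rightarrow> 'n \<Rightarrow> real) \<Rightarrow> nat \<Rightarrow> 'n tensor \<Rightarrow> bool" where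
  "primitive_cocycle C m \<Omega> \<longleftrightarrow>
     (\<exists>h. primitive_tensor C m h \<and> (\<forall>is\<in>idx (2 * m - 1). \<Omega> is = cocycle_of C m h is))"

text \<open>The tensor $t^{(m)}$ built from a cocycle of order $2m-1$; \<open>is ! (m - 1)\<close> is $i_m$.\<close>

definition assoc_tensor ::
    "('n::finite \<Rightarrow> 'n \<Rightarrow> 'n \<Rightarrow> real) \<Rightarrow> nat \<Rightarrow> 'n tensor \<Rightarrow> 'n tensor" where
  "assoc_tensor C m \<Omega> is =
     (\<Sum>js\<in>idx (2 * m - 2). \<Omega> (js @ [is ! (m - 1)]) * struct_prod C (m - 1) js is)"

end

theory Submission
  imports Defs
begin

text \<open>The tensor \<open>t\<^sub>l\<close> is a contraction of invariant tensors, hence invariant. Since \<open>l < m\<close>, all of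
  \<open>i\<^sub>1, \<dots>, i\<^sub>l\<close> sit on structure constants in \<open>t\<^sub>m\<close>, so that the contraction contains
  \<open>C(j\<^sub>1, j\<^sub>2, i\<^sub>1) \<cdots> C(j\<^bsub>2l-1\<^esub>, j\<^bsub>2l\<^esub>, i\<^sub>l) t\<^sub>l(i\<^sub>1, \<dots>, i\<^sub>l)\<close> summed against the
  skewsymmetric \<open>\<Omega>\<^sub>m\<close>. Reading the first factor as the action of \<open>X\<close> with index \<open>j\<^sub>1\<close> on the first slot of
  \<open>t\<^sub>l\<close>, invariance moves it to the other slots, where \<open>j\<^sub>1\<close> enters through a nested bracket with
  a pair \<open>j\<^bsub>2s-1\<^esub>, j\<^bsub>2s\<^esub>\<close>. The sum over the cyclic permutations of these three indices vanishes by
  the Jacobi identity, whereas \<open>\<Omega>\<^sub>m\<close> does not change under them, 3-cycles being even.\<close>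

section \<open>Sums over index lists\<close>

lemma finite_idx [simp]: "finite (idx n :: 'n::finite list set)"
  using finite_lists_length_eq[of "UNIV :: 'n set" n] by (simp add: idx_def)

lemma mem_idx [simp]: "xs \<in> idx n \<longleftrightarrow> length xs = n"
  by (simp add: idx_def)

lemma sum_lessThan_add:
  fixes f :: "nat \<Rightarrow> 'a::comm_monoid_add"
  shows "(\<Sum>i<p + r. f i) = (\<Sum>i<p. f i) + (\<Sum>i<r. f (p + i))"
  by (induction r) (simp_all add: add.assoc)

lemma sum_lessThan_double:
  fixes f :: "nat \<Rightarrow> 'a::comm_monoid_add"
  shows "(\<Sum>i<2 * q. f i) = (\<Sum>s<q. f (2 * s) + f (2 * s + 1))"
  by (induction q) (simp_all add: add.assoc)

lemma sum_idx_append: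
  fixes f :: "'n::finite list \<Rightarrow> 'a::comm_monoid_add"
  shows "(\<Sum>zs\<in>idx (p + q). f zs) = (\<Sum>xs\<in>idx p. \<Sum>ys\<in>idx q. f (xs @ ys))"
proof -
  have "(\<Sum>xs\<in>idx p. \<Sum>ys\<in>idx q. f (xs @ ys)) = (\<Sum>(xs, ys)\<in>idx p \<times> idx q. f (xs @ ys))"
    by (simp add: sum.cartesian_product)
  also have "\<dots> = (\<Sum>zs\<in>idx (p + q). f zs)"
    by (rule sum.reindex_bij_witness[where i = "\<lambda>zs. (take p zs, drop p zs)" and j = "\<lambda>(xs, ys). xs @ ys"])
       auto
  finally show ?thesis by simp
qed

lemma sum_idx_1:
  fixes f :: "'n::finite list \<Rightarrow> 'a::comm_monoid_add"
  shows "(\<Sum>xs\<in>idx 1. f xs) = (\<Sum>x\<in>UNIV. f [x])"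
  by (rule sum.reindex_bij_witness[where i = "\<lambda>x. [x]" and j = hd])
     (auto simp: length_Suc_conv)

lemma sum_idx_Suc:
  fixes f :: "'n::finite list \<Rightarrow> 'a::comm_monoid_add"
  shows "(\<Sum>xs\<in>idx (Suc n). f xs) = (\<Sum>x\<in>UNIV. \<Sum>xs\<in>idx n. f (x # xs))"
  using sum_idx_append[of f 1 n] unfolding sum_idx_1 by simp

lemma sum_idx_snoc:
  fixes f :: "'n::finite list \<Rightarrow> 'a::comm_monoid_add"
  shows "(\<Sum>xs\<in>idx (Suc n). f xs) = (\<Sum>xs\<in>idx n. \<Sum>x\<in>UNIV. f (xs @ [x]))"
  using sum_idx_append[of f n 1] unfolding sum_idx_1 by simp

text \<open>The map sending \<open>(xs, x)\<close> to \<open>(xs[s := x], xs ! s)\<close> is an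
  involution on the summation range. It is the device that moves an operator acting on slot
  \<open>s\<close> from one factor of a contraction to another.\<close>

lemma sum_idx_exchange:
  fixes f :: "'n::finite list \<Rightarrow> 'n \<Rightarrow> 'a::comm_monoid_add"
  assumes "s < q"
  shows "(\<Sum>xs\<in>idx q. \<Sum>x\<in>UNIV. f xs x) = (\<Sum>xs\<in>idx q. \<Sum>x\<in>UNIV. f (xs[s := x]) (xs ! s))"
proof -
  have "(\<Sum>(xs, x)\<in>idx q \<times> UNIV. f xs x) = (\<Sum>(xs, x)\<in>idx q \<times> UNIV. f (xs[s := x]) (xs ! s))"
    by (rule sum.reindex_bij_witness[where i = "\<lambda>(xs, x). (xs[s := x], xs ! s)"
          and j = "\<lambda>(xs, x). (xs[s := x], xs ! s)"]) (use assms in auto)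
  then show ?thesis by (simp add: sum.cartesian_product)
qed

lemma sum_idx_permute:
  fixes f :: "'n::finite list \<Rightarrow> 'a::comm_monoid_add"
  assumes \<tau>: "\<tau> permutes {..<n}"
  shows "(\<Sum>xs\<in>idx n. f (permute_list \<tau> xs)) = (\<Sum>xs\<in>idx n. f xs)"
proof -
  have inv: "inv \<tau> permutes {..<n}" using \<tau> by (rule permutes_inv)
  have "permute_list (inv \<tau>) (permute_list \<tau> xs) = xs" if "length xs = n" for xs :: "'n list"
    using permute_list_compose[of "inv \<tau>" xs \<tau>] that inv permutes_inv_o(1)[OF \<tau>] by simp
  moreover have "permute_list \<tau> (permute_list (inv \<tau>) xs) = xs" if "length xs = n" for xs :: "'n list"
    using permute_list_compose[of \<tau> xs "inv \<tau>"] that \<tau> permutes_inv_o(2)[OF \<tau>] by simp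
  ultimately show ?thesis
    by (intro sum.reindex_bij_witness[where i = "permute_list (inv \<tau>)" and j = "permute_list \<tau>"]) auto
qed


section \<open>The derivation of tensors induced by a matrix\<close>

text \<open>The matrix \<open>A\<close> acts on each slot in turn, as in the Leibniz rule. For
  \<open>A = C \<nu>\<close> this is the adjoint action of the basis vector with index
  \<open>\<nu>\<close>, and invariance means that it kills the tensor.\<close>

definition tensor_deriv :: "('n::finite \<Rightarrow> 'n \<Rightarrow> real) \<Rightarrow> nat \<Rightarrow> 'n tensor \<Rightarrow> 'n tensor" where
  "tensor_deriv A m h is = (\<Sum>s<m. \<Sum>\<rho>\<in>UNIV. A (is ! s) \<rho> * h (is[s := \<rho>]))"

lemma invariant_tensor_iff:
  "invariant_tensor C m h \<longleftrightarrow> (\<forall>\<nu>. \<forall>is\<in>idx m. tensor_deriv (C \<nu>) m h is = 0)"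
  by (simp add: invariant_tensor_def tensor_deriv_def)

lemma tensor_deriv_cong:
  assumes "\<And>xs. length xs = m \<Longrightarrow> f xs = g xs" "length is = m"
  shows "tensor_deriv A m f is = tensor_deriv A m g is"
  using assms by (simp add: tensor_deriv_def)

lemma invariant_tensor_cong:
  assumes "\<And>xs. length xs = m \<Longrightarrow> f xs = g xs"
  shows "invariant_tensor C m f \<longleftrightarrow> invariant_tensor C m g"
  using assms by (simp add: invariant_tensor_def)

section \<open>Leibniz rules and contractions of invariant tensors\<close>

lemma tensor_deriv_append:
  assumes "length a = p" "length y = r"
  shows "tensor_deriv A (p + r) f (a @ y) =
    tensor_deriv A p (\<lambda>a. f (a @ y)) a + tensor_deriv A r (\<lambda>y. f (a @ y)) y"
  using assms by (simp add: tensor_deriv_def sum_lessThan_add nth_append list_update_append)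

lemma tensor_deriv_sum_mult:
  "tensor_deriv A p (\<lambda>a. \<Sum>b\<in>B. f b a * c b) is = (\<Sum>b\<in>B. tensor_deriv A p (f b) is * c b)"
proof -
  have "tensor_deriv A p (\<lambda>a. \<Sum>b\<in>B. f b a * c b) is
      = (\<Sum>s<p. \<Sum>\<rho>\<in>UNIV. \<Sum>b\<in>B. A (is ! s) \<rho> * f b (is[s := \<rho>]) * c b)"
    by (simp add: tensor_deriv_def sum_distrib_left mult.assoc)
  also have "\<dots> = (\<Sum>s<p. \<Sum>b\<in>B. \<Sum>\<rho>\<in>UNIV. A (is ! s) \<rho> * f b (is[s := \<rho>]) * c b)"
    by (rule sum.cong[OF refl], rule sum.swap)
  also have "\<dots> = (\<Sum>b\<in>B. \<Sum>s<p. \<Sum>\<rho>\<in>UNIV. A (is ! s) \<rho> * f b (is[s := \<rho>]) * c b)"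
    by (rule sum.swap)
  finally show ?thesis
    by (simp add: tensor_deriv_def sum_distrib_right)
qed

lemma tensor_deriv_mult_right:
  "tensor_deriv A p (\<lambda>a. f a * c) is = tensor_deriv A p f is * c"
  by (simp add: tensor_deriv_def sum_distrib_right mult.assoc)

text \<open>Summation by parts: in each slot \<open>s\<close>, exchanging \<open>b ! s\<close> with
  the summed \<open>\<rho>\<close> moves the operator from \<open>f\<close> to \<open>g\<close> and
  transposes \<open>A\<close>, and skewness of \<open>A\<close> supplies the sign.\<close>

lemma tensor_deriv_adjoint:
  assumes A: "\<And>i j. A i j = - A j i"
  shows "(\<Sum>b\<in>idx q. tensor_deriv A q f b * g b) = - (\<Sum>b\<in>idx q. f b * tensor_deriv A q g b)"
proof -
  have "(\<Sum>b\<in>idx q. tensor_deriv A q f b * g b)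
      = (\<Sum>s<q. \<Sum>b\<in>idx q. \<Sum>\<rho>\<in>UNIV. A (b ! s) \<rho> * f (b[s := \<rho>]) * g b)"
    by (subst sum.swap) (simp add: tensor_deriv_def sum_distrib_right)
  also have "\<dots> = (\<Sum>s<q. \<Sum>b\<in>idx q. \<Sum>\<rho>\<in>UNIV. - (f b * (A (b ! s) \<rho> * g (b[s := \<rho>]))))"
  proof (rule sum.cong[OF refl])
    fix s assume "s \<in> {..<q}"
    then have "s < q" by simp
    show "(\<Sum>b\<in>idx q. \<Sum>\<rho>\<in>UNIV. A (b ! s) \<rho> * f (b[s := \<rho>]) * g b)
      = (\<Sum>b\<in>idx q. \<Sum>\<rho>\<in>UNIV. - (f b * (A (b ! s) \<rho> * g (b[s := \<rho>]))))"
      unfolding sum_idx_exchange[OF \<open>s < q\<close>, of "\<lambda>b \<rho>. A (b ! s) \<rho> * f (b[s := \<rho>]) * g b"]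
      using \<open>s < q\<close> by (intro sum.cong refl) (subst A, simp)
  qed
  also have "\<dots> = - (\<Sum>b\<in>idx q. f b * tensor_deriv A q g b)"
    by (subst sum.swap) (simp add: tensor_deriv_def sum_distrib_left sum_negf)
  finally show ?thesis .
qed

text \<open>Contracting invariant tensors gives an invariant tensor. The derivation in the free
  indices \<open>a\<close> acts on \<open>Q\<close>; invariance of \<open>Q\<close> trades it for
  the one in \<open>b\<close>, and summation by parts throws that onto \<open>H\<close>. Together
  with the derivation in the spectator indices \<open>y\<close> it is the full derivation of
  \<open>H\<close>, which vanishes.\<close>

lemma tensor_deriv_contraction:
  assumes A: "\<And>i j. A i j = - A j i"
    and Q: "\<And>a b. length a = p \<Longrightarrow> length b = q \<Longrightarrow>
      tensor_deriv A p (\<lambda>a. Q a b) a + tensor_deriv A q (Q a) b = 0"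
    and H: "\<And>b. length b = q + r \<Longrightarrow> tensor_deriv A (q + r) H b = 0"
    and F: "\<And>a y. length a = p \<Longrightarrow> length y = r \<Longrightarrow> F (a @ y) = (\<Sum>b\<in>idx q. H (b @ y) * Q a b)"
    and "length is = p + r"
  shows "tensor_deriv A (p + r) F is = 0"
proof -
  define a y where "a = take p is" and "y = drop p is"
  have "is": "is = a @ y" and a: "length a = p" and y: "length y = r"
    using assms(5) by (simp_all add: a_def y_def)
  have 1: "tensor_deriv A p (\<lambda>a. F (a @ y)) a = (\<Sum>b\<in>idx q. H (b @ y) * tensor_deriv A p (\<lambda>a. Q a b) a)"
    using tensor_deriv_sum_mult[of A p "\<lambda>b a. Q a b" "\<lambda>b. H (b @ y)" "idx q" a]
      tensor_deriv_cong[of p "\<lambda>a. F (a @ y)" "\<lambda>a. \<Sum>b\<in>idx q. Q a b * H (b @ y)" a A] F a y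
    by (simp add: mult.commute)
  also have "\<dots> = - (\<Sum>b\<in>idx q. H (b @ y) * tensor_deriv A q (Q a) b)"
    unfolding sum_negf[symmetric]
    by (rule sum.cong[OF refl]) (use Q[OF a] in \<open>simp add: eq_neg_iff_add_eq_0 flip: distrib_left\<close>)
  also have "\<dots> = (\<Sum>b\<in>idx q. tensor_deriv A q (\<lambda>b. H (b @ y)) b * Q a b)"
    using tensor_deriv_adjoint[of A q "\<lambda>b. H (b @ y)" "Q a", OF A] by simp
  finally have "tensor_deriv A p (\<lambda>a. F (a @ y)) a
      = (\<Sum>b\<in>idx q. tensor_deriv A q (\<lambda>b. H (b @ y)) b * Q a b)" .
  moreover have "tensor_deriv A r (\<lambda>y. F (a @ y)) y
      = (\<Sum>b\<in>idx q. tensor_deriv A r (\<lambda>y. H (b @ y)) y * Q a b)"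
    using tensor_deriv_sum_mult[of A r "\<lambda>b y. H (b @ y)" "Q a" "idx q" y]
      tensor_deriv_cong[of r "\<lambda>y. F (a @ y)" "\<lambda>y. \<Sum>b\<in>idx q. H (b @ y) * Q a b" y A] F a y
    by simp
  ultimately have "tensor_deriv A (p + r) F is
      = (\<Sum>b\<in>idx q. tensor_deriv A (q + r) H (b @ y) * Q a b)"
    unfolding "is" by (simp add: tensor_deriv_append a y distrib_right sum.distrib)
  also have "\<dots> = 0" using H y by simp
  finally show ?thesis .
qed


section \<open>The generalized epsilon symbol\<close>

text \<open>Substituting \<open>\<sigma> \<circ> \<tau>\<close> for the summation permutation and
  reordering the product by \<open>\<tau>\<close> restores the original terms, up to the factor
  \<open>sign \<tau>\<close>.\<close>

lemma gen_eps_permute_left: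
  assumes \<tau>: "\<tau> permutes {..<n}" and "length \<alpha> = n"
  shows "gen_eps n (permute_list \<tau> \<alpha>) \<beta> = of_int (sign \<tau>) * gen_eps n \<alpha> \<beta>"
proof -
  let ?d = "\<lambda>x y. if x = y then 1 else 0 :: real"
  have perm: "permutation \<sigma>" if "\<sigma> permutes {..<n}" for \<sigma>
    using that by (auto simp: permutation_permutes)
  have "gen_eps n (permute_list \<tau> \<alpha>) \<beta> = (\<Sum>\<sigma> | \<sigma> permutes {..<n}.
      of_int (sign (\<sigma> \<circ> \<tau>)) * (\<Prod>k<n. ?d (permute_list \<tau> \<alpha> ! k) (\<beta> ! ((\<sigma> \<circ> \<tau>) k))))"
    unfolding gen_eps_def
    by (rule sum.reindex_bij_betw[symmetric], rule bij_betw_byWitness[where f' = "\<lambda>\<sigma>. \<sigma> \<circ> inv \<tau>"])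
       (use \<tau> in \<open>auto simp: o_assoc[symmetric] permutes_inv_o permutes_compose permutes_inv\<close>)
  also have "\<dots> = (\<Sum>\<sigma> | \<sigma> permutes {..<n}.
      of_int (sign \<tau>) * (of_int (sign \<sigma>) * (\<Prod>k<n. ?d (\<alpha> ! k) (\<beta> ! \<sigma> k))))"
  proof (intro sum.cong refl)
    fix \<sigma> assume "\<sigma> \<in> {\<sigma>. \<sigma> permutes {..<n}}"
    then have \<sigma>: "\<sigma> permutes {..<n}" by simp
    have "(\<Prod>k<n. ?d (permute_list \<tau> \<alpha> ! k) (\<beta> ! ((\<sigma> \<circ> \<tau>) k)))
        = (\<Prod>k<n. ?d (\<alpha> ! \<tau> k) (\<beta> ! \<sigma> (\<tau> k)))"
      using assms by (intro prod.cong refl) (simp add: permute_list_nth)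
    also have "\<dots> = (\<Prod>k<n. ?d (\<alpha> ! k) (\<beta> ! \<sigma> k))"
      using prod.reindex_bij_betw[OF permutes_imp_bij[OF \<tau>], of "\<lambda>k. ?d (\<alpha> ! k) (\<beta> ! \<sigma> k)"] by simp
    finally show "of_int (sign (\<sigma> \<circ> \<tau>)) * (\<Prod>k<n. ?d (permute_list \<tau> \<alpha> ! k) (\<beta> ! ((\<sigma> \<circ> \<tau>) k)))
      = of_int (sign \<tau>) * (of_int (sign \<sigma>) * (\<Prod>k<n. ?d (\<alpha> ! k) (\<beta> ! \<sigma> k)))"
      by (simp add: sign_compose perm \<tau> \<sigma>)
  qed
  finally show ?thesis
    by (simp add: gen_eps_def sum_distrib_left)
qed

text \<open>The Kronecker delta is invariant under a skew matrix, and every term of the symbol is a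
  product of deltas. Acting on slot \<open>s\<close> of \<open>\<alpha>\<close> yields
  \<open>A (\<alpha> ! s) (\<beta> ! \<sigma> s)\<close>, acting on the matching slot of
  \<open>\<beta>\<close> yields the transposed entry, and the two cancel.\<close>

lemma tensor_deriv_gen_eps:
  assumes A: "\<And>i j. A i j = - A j i" and \<alpha>: "length \<alpha> = n" and \<beta>: "length \<beta> = n"
  shows "tensor_deriv A n (\<lambda>\<alpha>. gen_eps n \<alpha> \<beta>) \<alpha> + tensor_deriv A n (gen_eps n \<alpha>) \<beta> = 0"
proof -
  let ?d = "\<lambda>x y. if x = y then 1 else 0 :: real"
  have "tensor_deriv A n (\<lambda>\<alpha>. \<Prod>k<n. ?d (\<alpha> ! k) (\<beta> ! \<sigma> k)) \<alpha>
      + tensor_deriv A n (\<lambda>\<beta>. \<Prod>k<n. ?d (\<alpha> ! k) (\<beta> ! \<sigma> k)) \<beta> = 0"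
    if \<sigma>: "\<sigma> permutes {..<n}" for \<sigma>
  proof -
    let ?R = "\<lambda>s. \<Prod>k\<in>{..<n} - {s}. ?d (\<alpha> ! k) (\<beta> ! \<sigma> k)"
    have lt: "\<sigma> s < n \<longleftrightarrow> s < n" for s using permutes_in_image[OF \<sigma>, of s] by simp
    have inj: "\<sigma> s = \<sigma> k \<longleftrightarrow> s = k" for s k using permutes_inj[OF \<sigma>] by (simp add: inj_eq)
    have sum1: "(\<Sum>\<rho>\<in>UNIV. f \<rho> * (?d \<rho> x * R)) = f x * R" for f :: "'a \<Rightarrow> real" and x R
    proof -
      have "(\<Sum>\<rho>\<in>UNIV. f \<rho> * (?d \<rho> x * R)) = (\<Sum>\<rho>\<in>UNIV. if \<rho> = x then f \<rho> * R else 0)"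
        by (intro sum.cong) auto
      then show ?thesis by simp
    qed
    have sum2: "(\<Sum>\<rho>\<in>UNIV. f \<rho> * (?d x \<rho> * R)) = f x * R" for f :: "'a \<Rightarrow> real" and x R
      using sum1[of f x R] by (simp add: eq_commute)
    have "tensor_deriv A n (\<lambda>\<alpha>. \<Prod>k<n. ?d (\<alpha> ! k) (\<beta> ! \<sigma> k)) \<alpha>
        = (\<Sum>s<n. \<Sum>\<rho>\<in>UNIV. A (\<alpha> ! s) \<rho> * (?d \<rho> (\<beta> ! \<sigma> s) * ?R s))"
      unfolding tensor_deriv_def
    proof (intro sum.cong refl)
      fix s \<rho> assume s: "s \<in> {..<n}"
      show "A (\<alpha> ! s) \<rho> * (\<Prod>k<n. ?d (\<alpha>[s := \<rho>] ! k) (\<beta> ! \<sigma> k))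
        = A (\<alpha> ! s) \<rho> * (?d \<rho> (\<beta> ! \<sigma> s) * ?R s)"
        using s \<alpha> by (subst prod.remove[OF _ s]) auto
    qed
    also have "\<dots> = (\<Sum>s<n. A (\<alpha> ! s) (\<beta> ! \<sigma> s) * ?R s)"
      by (simp only: sum1)
    finally have 1: "tensor_deriv A n (\<lambda>\<alpha>. \<Prod>k<n. ?d (\<alpha> ! k) (\<beta> ! \<sigma> k)) \<alpha>
      = (\<Sum>s<n. A (\<alpha> ! s) (\<beta> ! \<sigma> s) * ?R s)" .
    \<comment> \<open>The slots of \<open>\<beta>\<close> are enumerated as
      \<open>\<sigma> s\<close>, so that the slot being differentiated is the one paired with
      \<open>\<alpha> ! s\<close>.\<close>
    have "tensor_deriv A n (\<lambda>\<beta>. \<Prod>k<n. ?d (\<alpha> ! k) (\<beta> ! \<sigma> k)) \<beta>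
        = (\<Sum>s<n. \<Sum>\<rho>\<in>UNIV. A (\<beta> ! \<sigma> s) \<rho> * (\<Prod>k<n. ?d (\<alpha> ! k) (\<beta>[\<sigma> s := \<rho>] ! \<sigma> k)))"
      unfolding tensor_deriv_def by (rule sum.reindex_bij_betw[OF permutes_imp_bij[OF \<sigma>], symmetric])
    also have "\<dots> = (\<Sum>s<n. \<Sum>\<rho>\<in>UNIV. A (\<beta> ! \<sigma> s) \<rho> * (?d (\<alpha> ! s) \<rho> * ?R s))"
    proof (intro sum.cong refl)
      fix s \<rho> assume s: "s \<in> {..<n}"
      show "A (\<beta> ! \<sigma> s) \<rho> * (\<Prod>k<n. ?d (\<alpha> ! k) (\<beta>[\<sigma> s := \<rho>] ! \<sigma> k))
        = A (\<beta> ! \<sigma> s) \<rho> * (?d (\<alpha> ! s) \<rho> * ?R s)"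
        using s \<beta> by (subst prod.remove[OF _ s]) (auto simp: lt inj)
    qed
    also have "\<dots> = (\<Sum>s<n. A (\<beta> ! \<sigma> s) (\<alpha> ! s) * ?R s)"
      by (simp only: sum2)
    also have "\<dots> = (\<Sum>s<n. - (A (\<alpha> ! s) (\<beta> ! \<sigma> s) * ?R s))"
      by (intro sum.cong refl) (subst A, simp)
    finally show ?thesis
      unfolding 1 by (simp add: sum_negf)
  qed
  then have "(\<Sum>\<sigma> | \<sigma> permutes {..<n}.
      (tensor_deriv A n (\<lambda>\<alpha>. \<Prod>k<n. ?d (\<alpha> ! k) (\<beta> ! \<sigma> k)) \<alpha>
      + tensor_deriv A n (\<lambda>\<beta>. \<Prod>k<n. ?d (\<alpha> ! k) (\<beta> ! \<sigma> k)) \<beta>) * of_int (sign \<sigma>)) = 0"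
    by (intro sum.neutral) simp
  then show ?thesis
    unfolding gen_eps_def distrib_right sum.distrib tensor_deriv_sum_mult[symmetric]
    by (simp add: mult.commute)
qed


section \<open>Structure constants\<close>

text \<open>The interface between the Lie algebra and the tensor calculus: total antisymmetry, with
  the third index lowered by the Kronecker delta, and the Jacobi identity in coordinates.\<close>

definition antisymmetric_jacobi :: "('n::finite \<Rightarrow> 'n \<Rightarrow> 'n \<Rightarrow> real) \<Rightarrow> bool" where
  "antisymmetric_jacobi C \<longleftrightarrow>
     (\<forall>i j k. C i j k = - C j i k) \<and> (\<forall>i j k. C i j k = - C i k j) \<and>
     (\<forall>i j k n. (\<Sum>\<rho>\<in>UNIV. C j k \<rho> * C i \<rho> n) + (\<Sum>\<rho>\<in>UNIV. C k i \<rho> * C j \<rho> n)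
        + (\<Sum>\<rho>\<in>UNIV. C i j \<rho> * C k \<rho> n) = 0)"

section \<open>Total antisymmetry of the structure constants from the Killing form\<close>

lemma coord_sum:
  fixes X :: "'n::finite \<Rightarrow> 'g::real_vector"
  assumes "indexed_basis X"
  shows "(\<Sum>k\<in>UNIV. coord X v k *\<^sub>R X k) = v"
proof -
  have X: "inj X" "independent (range X)" "v \<in> span (range X)"
    using assms by (auto simp: indexed_basis_def)
  have "(\<Sum>k\<in>UNIV. coord X v k *\<^sub>R X k) = (\<Sum>b\<in>range X. representation (range X) v b *\<^sub>R b)"
    using X(1) by (simp add: sum.reindex coord_def)
  also have "\<dots> = v"
    using real_vector.sum_representation_eq[OF X(2,3), of "range X"] by simp
  finally show ?thesis .
qed

lemma linear_coord:
  fixes X :: "'n::finite \<Rightarrow> 'g::real_vector"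
  assumes "indexed_basis X"
  shows "linear (\<lambda>v. coord X v k)"
  using assms unfolding coord_def indexed_basis_def
  by (intro linearI) (auto simp: real_vector.representation_add real_vector.representation_scale)

text \<open>Gives the matrix entries of a product of two adjoint maps. Both the Jacobi identity and
  the Killing form are translated into structure constants through it.\<close>

lemma coord_bracket_bracket:
  fixes X :: "'n::finite \<Rightarrow> 'g::real_vector"
  assumes X: "indexed_basis X" and "bilinear br"
  shows "coord X (br (X i) (br (X j) (X k))) n =
    (\<Sum>\<rho>\<in>UNIV. struct_const br X j k \<rho> * struct_const br X i \<rho> n)"
proof -
  have lin: "linear (br (X i))" using assms(2) by (simp add: bilinear_def)
  have "br (X i) (br (X j) (X k)) = br (X i) (\<Sum>\<rho>\<in>UNIV. struct_const br X j k \<rho> *\<^sub>R X \<rho>)"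
    by (simp add: struct_const_def coord_sum[OF X])
  also have "\<dots> = (\<Sum>\<rho>\<in>UNIV. struct_const br X j k \<rho> *\<^sub>R br (X i) (X \<rho>))"
    by (simp add: linear_sum[OF lin] linear_cmul[OF lin])
  finally show ?thesis
    by (simp add: linear_sum[OF linear_coord[OF X]] linear_cmul[OF linear_coord[OF X]] struct_const_def)
qed

lemma antisymmetric_jacobi_struct_const:
  fixes X :: "'n::finite \<Rightarrow> 'g::real_vector"
  assumes lie: "lie_bracket br" and X: "indexed_basis X" and orth: "killing_orthogonal br X"
  shows "antisymmetric_jacobi (struct_const br X)"
proof -
  define C where "C = struct_const br X"
  have bil: "bilinear br" and alt: "br x x = 0"
    and jac: "br x (br y z) + br y (br z x) + br z (br x y) = 0" for x y z
    using lie by (auto simp: lie_bracket_def)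
  have "br x y = - br y x" for x y
  proof -
    have "br (x + y) (x + y) = br x y + br y x"
      by (simp only: bilinear_ladd[OF bil] bilinear_radd[OF bil]) (simp add: alt)
    then show ?thesis by (metis alt eq_neg_iff_add_eq_0)
  qed
  then have anti: "C i j k = - C j i k" for i j k
    unfolding C_def struct_const_def by (metis linear_neg[OF linear_coord[OF X]])
  have J: "(\<Sum>\<rho>\<in>UNIV. C j k \<rho> * C i \<rho> n) + (\<Sum>\<rho>\<in>UNIV. C k i \<rho> * C j \<rho> n)
        + (\<Sum>\<rho>\<in>UNIV. C i j \<rho> * C k \<rho> n) = 0" for i j k n
    using arg_cong[OF jac[of "X i" "X j" "X k"], of "\<lambda>v. coord X v n"]
    by (simp add: C_def coord_bracket_bracket[OF X bil] linear_add[OF linear_coord[OF X]]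
        linear_0[OF linear_coord[OF X]])
  obtain c where c: "c > 0"
    and K: "\<And>i j. killing br X (X i) (X j) = - c * (if i = j then 1 else 0)"
    using orth unfolding killing_orthogonal_def by blast
  have K: "(\<Sum>a\<in>UNIV. \<Sum>b\<in>UNIV. C j a b * C i b a) = - c * (if i = j then 1 else 0)" for i j
    using K[of i j] by (simp add: killing_def coord_bracket_bracket[OF X bil] C_def)
  define T where "T i j k = (\<Sum>a\<in>UNIV. \<Sum>b\<in>UNIV. \<Sum>d\<in>UNIV. C i a b * C j b d * C k d a)" for i j k
  have T_cyclic: "T i j k = T j k i" for i j k
  proof -
    have "T j k i = (\<Sum>a\<in>UNIV. \<Sum>d\<in>UNIV. \<Sum>b\<in>UNIV. C j a b * C k b d * C i d a)"
      unfolding T_def by (intro sum.cong refl sum.swap)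
    also have "\<dots> = (\<Sum>d\<in>UNIV. \<Sum>a\<in>UNIV. \<Sum>b\<in>UNIV. C j a b * C k b d * C i d a)"
      by (rule sum.swap)
    finally show ?thesis by (simp add: T_def mult_ac)
  qed
  \<comment> \<open>With \<open>M i = (C i a b)\<close> as matrix, \<open>T i j k = tr (M i M j M k)\<close>, and by the Jacobi identity
    \<open>C i j \<rho> M \<rho>\<close> is the commutator of \<open>M j\<close> and \<open>M i\<close>.\<close>
  have comm: "(\<Sum>\<rho>\<in>UNIV. C i j \<rho> * C \<rho> a b)
      = (\<Sum>\<rho>\<in>UNIV. C j a \<rho> * C i \<rho> b) - (\<Sum>\<rho>\<in>UNIV. C i a \<rho> * C j \<rho> b)" for i j a b
  proof -
    have "(\<Sum>\<rho>\<in>UNIV. C i j \<rho> * C \<rho> a b) = - (\<Sum>\<rho>\<in>UNIV. C i j \<rho> * C a \<rho> b)"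
      unfolding sum_negf[symmetric] by (intro sum.cong refl) (subst anti[of _ a], simp)
    moreover have "(\<Sum>\<rho>\<in>UNIV. C a i \<rho> * C j \<rho> b) = - (\<Sum>\<rho>\<in>UNIV. C i a \<rho> * C j \<rho> b)"
      unfolding sum_negf[symmetric] by (intro sum.cong refl) (subst anti[of a], simp)
    ultimately show ?thesis using J[where n = b and i = i and j = j and k = a] by simp
  qed
  \<comment> \<open>The Killing form lowers the third index at the price of the factor
    \<open>- c\<close>. Inserting the commutator formula then turns the trace into a difference of
    traces of triple products.\<close>
  have lower: "- c * C i j k = T j i k - T i j k" for i j k
  proof -
    have "- c * C i j k = (\<Sum>\<rho>\<in>UNIV. if \<rho> = k then - c * C i j \<rho> else 0)"
      by simp
    also have "\<dots> = (\<Sum>\<rho>\<in>UNIV. C i j \<rho> * (\<Sum>a\<in>UNIV. \<Sum>d\<in>UNIV. C \<rho> a d * C k d a))"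
      unfolding K by (intro sum.cong refl) auto
    also have "\<dots> = (\<Sum>\<rho>\<in>UNIV. \<Sum>a\<in>UNIV. \<Sum>d\<in>UNIV. C i j \<rho> * C \<rho> a d * C k d a)"
      by (simp add: sum_distrib_left mult.assoc)
    also have "\<dots> = (\<Sum>a\<in>UNIV. \<Sum>\<rho>\<in>UNIV. \<Sum>d\<in>UNIV. C i j \<rho> * C \<rho> a d * C k d a)"
      by (rule sum.swap)
    also have "\<dots> = (\<Sum>a\<in>UNIV. \<Sum>d\<in>UNIV. \<Sum>\<rho>\<in>UNIV. C i j \<rho> * C \<rho> a d * C k d a)"
      by (intro sum.cong refl sum.swap)
    also have "\<dots> = (\<Sum>a\<in>UNIV. \<Sum>d\<in>UNIV. (\<Sum>\<rho>\<in>UNIV. C j a \<rho> * C i \<rho> d * C k d a)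
        - (\<Sum>\<rho>\<in>UNIV. C i a \<rho> * C j \<rho> d * C k d a))"
      by (simp add: comm left_diff_distrib flip: sum_distrib_right)
    also have "\<dots> = (\<Sum>a\<in>UNIV. \<Sum>d\<in>UNIV. \<Sum>\<rho>\<in>UNIV. C j a \<rho> * C i \<rho> d * C k d a)
        - (\<Sum>a\<in>UNIV. \<Sum>d\<in>UNIV. \<Sum>\<rho>\<in>UNIV. C i a \<rho> * C j \<rho> d * C k d a)"
      by (simp add: sum_subtractf)
    also have "\<dots> = T j i k - T i j k"
      unfolding T_def by (intro arg_cong2[where f = minus] sum.cong refl sum.swap)
    finally show ?thesis .
  qed
  \<comment> \<open>Exchanging \<open>j\<close> and \<open>k\<close> gives the same two traces, up
    to cyclic rotation, with opposite signs.\<close>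
  have "c * (C i j k + C i k j) = 0" for i j k
    using lower[of i j k] lower[of i k j] T_cyclic[of j i k] T_cyclic[of k i j]
    by (simp add: distrib_left)
  then have "C i j k = - C i k j" for i j k
    using c by (metis add_eq_0_iff2 mult_eq_0_iff less_irrefl)
  then show ?thesis
    using anti J unfolding antisymmetric_jacobi_def C_def[symmetric] by blast
qed

lemma antisymmetric_jacobiD:
  assumes "antisymmetric_jacobi C"
  shows "C i j k = - C j i k" "C i j k = - C i k j"
    "(\<Sum>\<rho>\<in>UNIV. C j k \<rho> * C i \<rho> n) + (\<Sum>\<rho>\<in>UNIV. C k i \<rho> * C j \<rho> n)
        + (\<Sum>\<rho>\<in>UNIV. C i j \<rho> * C k \<rho> n) = 0"
  using assms unfolding antisymmetric_jacobi_def by blast+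

text \<open>This is the Jacobi identity, rearranged by antisymmetry into the statement that
  \<open>C\<close> is itself an invariant tensor of order 3.\<close>

lemma struct_const_invariant:
  assumes C: "antisymmetric_jacobi C"
  shows "(\<Sum>\<rho>\<in>UNIV. C \<nu> i \<rho> * C \<rho> j k) + (\<Sum>\<rho>\<in>UNIV. C \<nu> j \<rho> * C i \<rho> k)
    + (\<Sum>\<rho>\<in>UNIV. C \<nu> k \<rho> * C i j \<rho>) = 0"
proof -
  note anti = antisymmetric_jacobiD(1,2)[OF C]
  have "(\<Sum>\<rho>\<in>UNIV. C \<nu> i \<rho> * C \<rho> j k) = - (\<Sum>\<rho>\<in>UNIV. C \<nu> i \<rho> * C j \<rho> k)"
    unfolding sum_negf[symmetric] by (intro sum.cong refl) (subst anti(1)[of _ j], simp)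
  moreover have "(\<Sum>\<rho>\<in>UNIV. C \<nu> j \<rho> * C i \<rho> k) = - (\<Sum>\<rho>\<in>UNIV. C j \<nu> \<rho> * C i \<rho> k)"
    unfolding sum_negf[symmetric] by (intro sum.cong refl) (subst anti(1)[of _ j], simp)
  moreover have "(\<Sum>\<rho>\<in>UNIV. C \<nu> k \<rho> * C i j \<rho>) = - (\<Sum>\<rho>\<in>UNIV. C i j \<rho> * C \<nu> \<rho> k)"
    unfolding sum_negf[symmetric] by (intro sum.cong refl) (subst anti(2)[of _ k], simp)
  ultimately show ?thesis
    using antisymmetric_jacobiD(3)[OF C, where i = \<nu> and j = i and k = j and n = k] by simp
qed

section \<open>Invariance of products of structure constants\<close>

lemma struct_prod_cong:
  assumes "\<And>s. s < q \<Longrightarrow> js ! (2 * s) = js' ! (2 * s)"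
    "\<And>s. s < q \<Longrightarrow> js ! Suc (2 * s) = js' ! Suc (2 * s)" "\<And>s. s < q \<Longrightarrow> ls ! s = ls' ! s"
  shows "struct_prod C q js ls = struct_prod C q js' ls'"
  using assms by (simp add: struct_prod_def)

text \<open>Factor \<open>s\<close> owns slots \<open>2 * s\<close> and \<open>2 * s + 1\<close> of
  \<open>js\<close> and slot \<open>s\<close> of \<open>ls\<close>. The three contributions of these
  slots share the cofactor \<open>?R s\<close> and add up to zero by the invariance of
  \<open>C\<close>.\<close>

lemma tensor_deriv_struct_prod:
  assumes C: "antisymmetric_jacobi C" and js: "length js = 2 * q" and ls: "length ls = q"
  shows "tensor_deriv (C \<nu>) (2 * q) (\<lambda>js. struct_prod C q js ls) js
    + tensor_deriv (C \<nu>) q (struct_prod C q js) ls = 0"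
proof -
  let ?R = "\<lambda>s. \<Prod>k\<in>{..<q} - {s}. C (js ! (2 * k)) (js ! (2 * k + 1)) (ls ! k)"
  have 1: "struct_prod C q (js[2 * s := \<rho>]) ls = C \<rho> (js ! (2 * s + 1)) (ls ! s) * ?R s"
    and 2: "struct_prod C q (js[2 * s + 1 := \<rho>]) ls = C (js ! (2 * s)) \<rho> (ls ! s) * ?R s"
    and 3: "struct_prod C q js (ls[s := \<rho>]) = C (js ! (2 * s)) (js ! (2 * s + 1)) \<rho> * ?R s"
    if s: "s < q" for s \<rho>
  proof -
    have split: "struct_prod C q js' ls' = C (js' ! (2 * s)) (js' ! (2 * s + 1)) (ls' ! s)
        * (\<Prod>k\<in>{..<q} - {s}. C (js' ! (2 * k)) (js' ! (2 * k + 1)) (ls' ! k))" for js' ls'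
      unfolding struct_prod_def using s by (intro prod.remove) auto
    have parity: "2 * s \<noteq> 2 * k + 1" "2 * s + 1 \<noteq> 2 * k" for k by presburger+
    have "js[2 * s := \<rho>] ! (2 * k + 1) = js ! (2 * k + 1)" "js[2 * s + 1 := \<rho>] ! (2 * k) = js ! (2 * k)"
      "js[2 * s := \<rho>] ! (2 * s) = \<rho>" "js[2 * s + 1 := \<rho>] ! (2 * s + 1) = \<rho>" "ls[s := \<rho>] ! s = \<rho>"
      "k \<noteq> s \<Longrightarrow> js[2 * s := \<rho>] ! (2 * k) = js ! (2 * k)"
      "k \<noteq> s \<Longrightarrow> js[2 * s + 1 := \<rho>] ! (2 * k + 1) = js ! (2 * k + 1)"
      "k \<noteq> s \<Longrightarrow> ls[s := \<rho>] ! k = ls ! k" for k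
      using s js ls parity[of k] by (simp_all only: nth_list_update_neq) simp_all
    note upd = this
    show "struct_prod C q (js[2 * s := \<rho>]) ls = C \<rho> (js ! (2 * s + 1)) (ls ! s) * ?R s"
      "struct_prod C q (js[2 * s + 1 := \<rho>]) ls = C (js ! (2 * s)) \<rho> (ls ! s) * ?R s"
      "struct_prod C q js (ls[s := \<rho>]) = C (js ! (2 * s)) (js ! (2 * s + 1)) \<rho> * ?R s"
      unfolding split upd(1-5)
      by (rule arg_cong2[where f = times, OF refl prod.cong[OF refl]], use upd in auto)+
  qed
  have "tensor_deriv (C \<nu>) (2 * q) (\<lambda>js. struct_prod C q js ls) js
    + tensor_deriv (C \<nu>) q (struct_prod C q js) ls
    = (\<Sum>s<q. ((\<Sum>\<rho>\<in>UNIV. C \<nu> (js ! (2 * s)) \<rho> * C \<rho> (js ! (2 * s + 1)) (ls ! s))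
        + (\<Sum>\<rho>\<in>UNIV. C \<nu> (js ! (2 * s + 1)) \<rho> * C (js ! (2 * s)) \<rho> (ls ! s))
        + (\<Sum>\<rho>\<in>UNIV. C \<nu> (ls ! s) \<rho> * C (js ! (2 * s)) (js ! (2 * s + 1)) \<rho>)) * ?R s)"
    unfolding tensor_deriv_def sum_lessThan_double sum.distrib[symmetric]
    by (intro sum.cong refl)
       (simp only: lessThan_iff 1 2 3 distrib_right sum_distrib_right mult.assoc sum.distrib)
  also have "\<dots> = 0"
    by (simp only: struct_const_invariant[OF C]) simp
  finally show ?thesis .
qed


section \<open>Cocycles and their associated tensors\<close>

text \<open>Merging \<open>js\<close> and \<open>\<rho>\<close> into one list \<open>xs\<close>
  exhibits the cocycle as two nested contractions, first of \<open>h\<close> with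
  \<open>struct_prod\<close> and then of the result with \<open>gen_eps\<close>. Writing the order
  as \<open>Suc n\<close> removes the truncated subtractions.\<close>

lemma cocycle_of_Suc:
  "cocycle_of C (Suc n) h is = (1 / fact (Suc (2 * n))) * (\<Sum>xs\<in>idx (Suc (2 * n)).
     gen_eps (Suc (2 * n)) is xs * (\<Sum>ls\<in>idx n. h (ls @ [xs ! (2 * n)]) * struct_prod C n (take (2 * n) xs) ls))"
  unfolding cocycle_of_def sum_idx_snoc
  by (simp add: sum_distrib_left nth_append mult_ac)

lemma cocycle_of_permute:
  assumes "\<tau> permutes {..<2 * m - 1}" "length is = 2 * m - 1"
  shows "cocycle_of C m h (permute_list \<tau> is) = of_int (sign \<tau>) * cocycle_of C m h is"
  unfolding cocycle_of_def gen_eps_permute_left[OF assms] by (simp add: sum_distrib_left mult_ac)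

lemma invariant_cocycle_of:
  fixes C :: "'n::finite \<Rightarrow> 'n \<Rightarrow> 'n \<Rightarrow> real"
  assumes C: "antisymmetric_jacobi C" and h: "invariant_tensor C (Suc n) h"
  shows "invariant_tensor C (Suc (2 * n)) (cocycle_of C (Suc n) h)"
  unfolding invariant_tensor_iff
proof (intro allI ballI)
  fix \<nu> and "is" :: "'n list" assume "is": "is \<in> idx (Suc (2 * n))"
  have anti: "C \<nu> i j = - C \<nu> j i" for i j by (rule antisymmetric_jacobiD(2)[OF C])
  define G where "G xs = (\<Sum>ls\<in>idx n. h (ls @ [xs ! (2 * n)]) * struct_prod C n (take (2 * n) xs) ls)"
    for xs
  have G: "tensor_deriv (C \<nu>) (2 * n + 1) G xs = 0" if "length xs = 2 * n + 1" for xs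
  proof (rule tensor_deriv_contraction[where A = "C \<nu>" and H = h and q = n and Q = "struct_prod C n"])
    show "tensor_deriv (C \<nu>) (2 * n) (\<lambda>a. struct_prod C n a b) a
        + tensor_deriv (C \<nu>) n (struct_prod C n a) b = 0" if "length a = 2 * n" "length b = n" for a b
      using tensor_deriv_struct_prod[OF C that] .
    show "tensor_deriv (C \<nu>) (n + 1) h b = 0" if "length b = n + 1" for b
      using h that by (simp add: invariant_tensor_iff)
    show "G (a @ y) = (\<Sum>b\<in>idx n. h (b @ y) * struct_prod C n a b)"
      if "length a = 2 * n" "length y = 1" for a y
      using that by (auto simp: G_def nth_append length_Suc_conv)
  qed (use that in \<open>auto intro: anti\<close>)
  \<comment> \<open>The symbol contracts every index of \<open>G\<close>, so there are no spectator
    indices; hence the \<open>+ 0\<close>.\<close>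
  have "tensor_deriv (C \<nu>) (Suc (2 * n) + 0) (cocycle_of C (Suc n) h) is = 0"
  proof (rule tensor_deriv_contraction[where A = "C \<nu>" and q = "Suc (2 * n)" and
        H = "\<lambda>xs. G xs * (1 / fact (Suc (2 * n)))" and Q = "gen_eps (Suc (2 * n))"])
    show "tensor_deriv (C \<nu>) (Suc (2 * n)) (\<lambda>a. gen_eps (Suc (2 * n)) a b) a
        + tensor_deriv (C \<nu>) (Suc (2 * n)) (gen_eps (Suc (2 * n)) a) b = 0"
      if "length a = Suc (2 * n)" "length b = Suc (2 * n)" for a b
      using tensor_deriv_gen_eps[OF anti that] .
    show "tensor_deriv (C \<nu>) (Suc (2 * n) + 0) (\<lambda>xs. G xs * (1 / fact (Suc (2 * n)))) b = 0"
      if "length b = Suc (2 * n) + 0" for b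
      unfolding tensor_deriv_mult_right using G[of b] that by simp
    show "cocycle_of C (Suc n) h (a @ y) =
        (\<Sum>b\<in>idx (Suc (2 * n)). G (b @ y) * (1 / fact (Suc (2 * n))) * gen_eps (Suc (2 * n)) a b)"
      if "length a = Suc (2 * n)" "length y = 0" for a y
      using that unfolding cocycle_of_Suc G_def[symmetric]
      by (simp add: sum_distrib_left sum_divide_distrib mult_ac del: fact_Suc)
  qed (use "is" in \<open>auto intro: anti\<close>)
  then show "tensor_deriv (C \<nu>) (Suc (2 * n)) (cocycle_of C (Suc n) h) is = 0" by simp
qed

text \<open>Again a contraction with \<open>struct_prod\<close>, with its two index groups in
  exchanged roles: the pairs \<open>js\<close> are summed against \<open>\<Omega>\<close> and the
  third indices stay free. The last index of \<open>\<Omega>\<close> is the spectator.\<close>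

lemma invariant_assoc_tensor:
  fixes C :: "'n::finite \<Rightarrow> 'n \<Rightarrow> 'n \<Rightarrow> real"
  assumes C: "antisymmetric_jacobi C" and \<Omega>: "invariant_tensor C (Suc (2 * n)) \<Omega>"
  shows "invariant_tensor C (Suc n) (assoc_tensor C (Suc n) \<Omega>)"
  unfolding invariant_tensor_iff
proof (intro allI ballI)
  fix \<nu> and "is" :: "'n list" assume "is": "is \<in> idx (Suc n)"
  have "tensor_deriv (C \<nu>) (n + 1) (assoc_tensor C (Suc n) \<Omega>) is = 0"
  proof (rule tensor_deriv_contraction[where A = "C \<nu>" and H = \<Omega> and q = "2 * n"
        and Q = "\<lambda>is js. struct_prod C n js is"])
    show "C \<nu> i j = - C \<nu> j i" for i j by (rule antisymmetric_jacobiD(2)[OF C])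
    show "tensor_deriv (C \<nu>) n (\<lambda>a. struct_prod C n b a) a
        + tensor_deriv (C \<nu>) (2 * n) (\<lambda>b. struct_prod C n b a) b = 0"
      if "length a = n" "length b = 2 * n" for a b
      using tensor_deriv_struct_prod[OF C that(2,1), of \<nu>] by (simp add: add.commute)
    show "tensor_deriv (C \<nu>) (2 * n + 1) \<Omega> b = 0" if "length b = 2 * n + 1" for b
      using \<Omega> that by (simp add: invariant_tensor_iff)
    show "assoc_tensor C (Suc n) \<Omega> (a @ y) = (\<Sum>b\<in>idx (2 * n). \<Omega> (b @ y) * struct_prod C n b a)"
      if "length a = n" "length y = 1" for a y
      unfolding assoc_tensor_def using that
      by (auto simp: length_Suc_conv nth_append intro!: sum.cong arg_cong2[where f = times] struct_prod_cong)
  qed (use "is" in auto)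
  then show "tensor_deriv (C \<nu>) (Suc n) (assoc_tensor C (Suc n) \<Omega>) is = 0" by simp
qed


section \<open>Orthogonality\<close>

text \<open>Invariance of \<open>k\<close> moves \<open>ad X\<close> with index \<open>js ! 0\<close> from the first slot of \<open>k\<close>, which then
  carries \<open>js ! 1\<close>, to the other ones; this is the term (up to sign) for slot \<open>r + 1\<close>.\<close>

definition moved_term :: "('n::finite \<Rightarrow> 'n \<Rightarrow> 'n \<Rightarrow> real) \<Rightarrow> nat \<Rightarrow> 'n tensor \<Rightarrow> nat \<Rightarrow> 'n tensor" where
  "moved_term C p k r js = (\<Sum>is\<in>idx p. k (js ! 1 # is) *
     (\<Prod>s\<in>{..<p} - {r}. C (js ! (2 * s + 2)) (js ! (2 * s + 3)) (is ! s)) *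
     (\<Sum>\<rho>\<in>UNIV. C (js ! (2 * r + 2)) (js ! (2 * r + 3)) \<rho> * C (js ! 0) \<rho> (is ! r)))"

text \<open>The factor for \<open>s = 0\<close> summed against \<open>k\<close> is the first-slot
  term of the invariance identity of \<open>k\<close> for \<open>\<nu> = js ! 0\<close> at the index
  list \<open>js ! 1 # is\<close>. The terms of the other slots appear with a minus sign.\<close>

lemma struct_prod_contraction:
  assumes k: "invariant_tensor C (Suc p) k"
  shows "(\<Sum>is\<in>idx (Suc p). struct_prod C (Suc p) js is * k is) = - (\<Sum>r<p. moved_term C p k r js)"
proof -
  \<comment> \<open>The factors left after the first one is split off; the list \<open>is\<close>
    has lost its head too, so its slot \<open>s\<close> goes with positions \<open>2 * s + 2\<close>
    and \<open>2 * s + 3\<close> of \<open>js\<close>.\<close>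
  define P where "P is = (\<Prod>s<p. C (js ! (2 * s + 2)) (js ! (2 * s + 3)) (is ! s))" for "is"
  have "(\<Sum>is\<in>idx (Suc p). struct_prod C (Suc p) js is * k is)
      = (\<Sum>\<rho>\<in>UNIV. \<Sum>is\<in>idx p. P is * (C (js ! 0) (js ! 1) \<rho> * k (\<rho> # is)))"
    unfolding sum_idx_Suc struct_prod_def P_def prod.lessThan_Suc_shift
    by (simp add: mult_ac numeral_3_eq_3)
  also have "\<dots> = (\<Sum>is\<in>idx p. P is * (\<Sum>\<rho>\<in>UNIV. C (js ! 0) (js ! 1) \<rho> * k (\<rho> # is)))"
    by (subst sum.swap) (simp add: sum_distrib_left)
  also have "\<dots> = (\<Sum>is\<in>idx p. - (\<Sum>r<p. \<Sum>\<rho>\<in>UNIV. P is * (C (js ! 0) (is ! r) \<rho> * k (js ! 1 # is[r := \<rho>]))))"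
  proof (rule sum.cong[OF refl])
    fix "is" :: "'a list" assume "is \<in> idx p"
    then have "tensor_deriv (C (js ! 0)) (Suc p) k (js ! 1 # is) = 0"
      using k by (simp add: invariant_tensor_iff)
    then have "(\<Sum>\<rho>\<in>UNIV. C (js ! 0) (js ! 1) \<rho> * k (\<rho> # is))
        = - (\<Sum>r<p. \<Sum>\<rho>\<in>UNIV. C (js ! 0) (is ! r) \<rho> * k (js ! 1 # is[r := \<rho>]))"
      unfolding tensor_deriv_def sum.lessThan_Suc_shift by (simp add: eq_neg_iff_add_eq_0)
    then show "P is * (\<Sum>\<rho>\<in>UNIV. C (js ! 0) (js ! 1) \<rho> * k (\<rho> # is))
      = - (\<Sum>r<p. \<Sum>\<rho>\<in>UNIV. P is * (C (js ! 0) (is ! r) \<rho> * k (js ! 1 # is[r := \<rho>])))"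
      by (simp add: sum_distrib_left)
  qed
  also have "\<dots> = - (\<Sum>r<p. \<Sum>is\<in>idx p. \<Sum>\<rho>\<in>UNIV. P is * (C (js ! 0) (is ! r) \<rho> * k (js ! 1 # is[r := \<rho>])))"
    unfolding sum_negf by (subst sum.swap) simp
  also have "\<dots> = - (\<Sum>r<p. moved_term C p k r js)"
  proof (intro arg_cong[where f = uminus] sum.cong refl)
    fix r assume r': "r \<in> {..<p}"
    then have r: "r < p" by simp
    let ?R = "\<lambda>is. \<Prod>s\<in>{..<p} - {r}. C (js ! (2 * s + 2)) (js ! (2 * s + 3)) (is ! s)"
    have P: "P (is[r := \<rho>]) = C (js ! (2 * r + 2)) (js ! (2 * r + 3)) \<rho> * ?R is"
      if "length is = p" for "is" \<rho>
      unfolding P_def using r that by (subst prod.remove[OF _ r']) auto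
    \<comment> \<open>Exchanging \<open>is ! r\<close> with \<open>\<rho>\<close> frees
      \<open>k\<close> of the substitution and leaves the nested bracket of \<open>js ! 0\<close>
      with the pair of factor \<open>r\<close>.\<close>
    show "(\<Sum>is\<in>idx p. \<Sum>\<rho>\<in>UNIV. P is * (C (js ! 0) (is ! r) \<rho> * k (js ! 1 # is[r := \<rho>])))
      = moved_term C p k r js"
      unfolding moved_term_def sum_idx_exchange[OF r,
          of "\<lambda>is \<rho>. P is * (C (js ! 0) (is ! r) \<rho> * k (js ! 1 # is[r := \<rho>]))"]
        sum_distrib_left
      using r by (intro sum.cong refl) (simp add: P mult_ac)
  qed
  finally show ?thesis .
qed

text \<open>Positions \<open>0\<close>, \<open>2 * r + 2\<close> and \<open>2 * r + 3\<close> of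
  \<open>js\<close> occur only in the nested bracket; the remaining factors \<open>?R\<close> are
  the same for all three rotations. The three brackets sum to zero by the Jacobi identity.\<close>

lemma moved_term_cyclic:
  assumes C: "antisymmetric_jacobi C"
    and c: "\<tau> 0 = 2 * r + 2" "\<tau> (2 * r + 2) = 2 * r + 3" "\<tau> (2 * r + 3) = 0"
      "\<And>x. x \<notin> {0, 2 * r + 2, 2 * r + 3} \<Longrightarrow> \<tau> x = x"
    and \<tau>: "\<tau> permutes {..<length js}" and "r < p" "2 * p + 2 \<le> length js"
  shows "moved_term C p k r js + moved_term C p k r (permute_list \<tau> js)
    + moved_term C p k r (permute_list \<tau> (permute_list \<tau> js)) = 0"
proof -
  define J where "J a b c n = (\<Sum>\<rho>\<in>UNIV. C b c \<rho> * C a \<rho> n)" for a b c n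
  have nth: "permute_list \<tau> js ! x = js ! \<tau> x"
    "permute_list \<tau> (permute_list \<tau> js) ! x = js ! \<tau> (\<tau> x)" if "x < length js" for x
    using \<tau> that permutes_in_image[OF \<tau>, of x] by (simp_all add: permute_list_nth)
  have len: "0 < length js" "Suc 0 < length js" "2 * r + 2 < length js" "2 * r + 3 < length js"
    using assms(7,8) by linarith+
  have fixed: "\<tau> 1 = 1"
    by (rule c(4)) simp
  have fixed': "\<tau> (2 * s + 2) = 2 * s + 2" "\<tau> (2 * s + 3) = 2 * s + 3" if "s \<noteq> r" for s
    by (rule c(4); use that in simp; presburger)+
  let ?R = "\<lambda>js is. k (js ! 1 # is) *
     (\<Prod>s\<in>{..<p} - {r}. C (js ! (2 * s + 2)) (js ! (2 * s + 3)) (is ! s))"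
  have R: "?R (permute_list \<tau> js) is = ?R js is"
    "?R (permute_list \<tau> (permute_list \<tau> js)) is = ?R js is" for "is"
  proof -
    have "2 * s + 2 < length js" "2 * s + 3 < length js" if "s < p" for s
      using that assms(8) by linarith+
    moreover have "1 < length js" using len(2) by simp
    ultimately show "?R (permute_list \<tau> js) is = ?R js is"
      "?R (permute_list \<tau> (permute_list \<tau> js)) is = ?R js is"
      by (simp_all only: nth fixed, (intro arg_cong2[where f = times] refl prod.cong,
          simp only: nth fixed' Diff_iff singleton_iff lessThan_iff not_False_eq_True)+)
  qed
  have "moved_term C p k r js + moved_term C p k r (permute_list \<tau> js)
    + moved_term C p k r (permute_list \<tau> (permute_list \<tau> js))
    = (\<Sum>is\<in>idx p. ?R js is * (J (js ! 0) (js ! (2 * r + 2)) (js ! (2 * r + 3)) (is ! r)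
        + J (js ! (2 * r + 2)) (js ! (2 * r + 3)) (js ! 0) (is ! r)
        + J (js ! (2 * r + 3)) (js ! 0) (js ! (2 * r + 2)) (is ! r)))"
    unfolding moved_term_def J_def[symmetric] R nth[OF len(1)] nth[OF len(3)] nth[OF len(4)] c(1-3)
    by (simp only: distrib_left sum.distrib)
  also have "\<dots> = 0"
    using antisymmetric_jacobiD(3)[OF C] by (simp add: J_def)
  finally show ?thesis .
qed

text \<open>Averaging over a 3-cycle: relabelling the summation list by \<open>\<tau>\<close> leaves
  the sum unchanged, so three times the sum equals the sum over the three rotations.
  \<open>W\<close> and \<open>V\<close> factor out, and what remains cancels.\<close>

lemma sum_moved_term:
  assumes C: "antisymmetric_jacobi C" and r: "r < p" and N: "2 * p + 2 \<le> N"
    and even: "\<And>\<tau> js. \<tau> permutes {..<2 * p + 2} \<Longrightarrow> sign \<tau> = 1 \<Longrightarrow> length js = N \<Longrightarrow>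
      W (permute_list \<tau> js) = W js"
    and V: "\<And>\<tau> js. \<tau> permutes {..<2 * p + 2} \<Longrightarrow> length js = N \<Longrightarrow> V (permute_list \<tau> js) = V js"
  shows "(\<Sum>js\<in>idx N. W js * V js * moved_term C p k r js) = 0"
proof -
  \<comment> \<open>The cycle taking \<open>0\<close> to \<open>2 * r + 2\<close>, then to
    \<open>2 * r + 3\<close>, then back to \<open>0\<close>. As a product of two transpositions it
    is even.\<close>
  define \<tau> :: "nat \<Rightarrow> nat" where "\<tau> = Transposition.transpose 0 (2 * r + 3) \<circ> Transposition.transpose 0 (2 * r + 2)"
  have c: "\<tau> 0 = 2 * r + 2" "\<tau> (2 * r + 2) = 2 * r + 3" "\<tau> (2 * r + 3) = 0"
    "\<And>x. x \<notin> {0, 2 * r + 2, 2 * r + 3} \<Longrightarrow> \<tau> x = x"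
    by (auto simp: \<tau>_def Transposition.transpose_def)
  have \<tau>: "\<tau> permutes {..<2 * p + 2}"
    unfolding \<tau>_def using r by (intro permutes_compose permutes_swap_id) auto
  have \<tau>N: "\<tau> permutes {..<N}" using \<tau> N by (meson lessThan_subset_iff permutes_subset)
  have sgn: "sign \<tau> = 1"
    by (simp add: \<tau>_def sign_compose permutation_swap_id sign_swap_id)
  define f where "f js = W js * V js * moved_term C p k r js" for js
  have "3 * (\<Sum>js\<in>idx N. f js) = (\<Sum>js\<in>idx N. f js) + (\<Sum>js\<in>idx N. f (permute_list \<tau> js))
      + (\<Sum>js\<in>idx N. f (permute_list \<tau> (permute_list \<tau> js)))"
    using sum_idx_permute[OF \<tau>N, of f] sum_idx_permute[OF \<tau>N, of "\<lambda>js. f (permute_list \<tau> js)"] by simp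
  also have "\<dots> = (\<Sum>js\<in>idx N. W js * V js * (moved_term C p k r js + moved_term C p k r (permute_list \<tau> js)
      + moved_term C p k r (permute_list \<tau> (permute_list \<tau> js))))"
    using even[OF \<tau> sgn] V[OF \<tau>] by (simp add: f_def distrib_left sum.distrib)
  also have "\<dots> = 0"
    using moved_term_cyclic[OF C c, of _ p k] \<tau>N r N by (intro sum.neutral) simp
  finally show ?thesis by (simp add: f_def)
qed

text \<open>Since \<open>p < n\<close>, the contracted indices all sit on the first
  \<open>Suc p\<close> structure constants. The other constants and the last index of
  \<open>\<Omega>\<close> depend only on \<open>ks\<close> and on positions of \<open>js\<close>
  that the 3-cycles fix.\<close>

lemma assoc_tensor_contraction:
  assumes C: "antisymmetric_jacobi C" and k: "invariant_tensor C (Suc p) k" and "p < n"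
    and even: "\<And>\<tau> xs. \<tau> permutes {..<2 * n + 1} \<Longrightarrow> sign \<tau> = 1 \<Longrightarrow> length xs = 2 * n + 1 \<Longrightarrow>
      \<Omega> (permute_list \<tau> xs) = \<Omega> xs"
    and ks: "length ks = n - p"
  shows "(\<Sum>is\<in>idx (Suc p). assoc_tensor C (Suc n) \<Omega> (is @ ks) * k is) = 0"
proof -
  define N where "N = 2 * n"
  \<comment> \<open>The last entry of \<open>ks\<close>, that is the index \<open>i_m\<close>
    carried by \<open>\<Omega>\<close> itself. The earlier entries of \<open>ks\<close> go into
    \<open>V\<close>.\<close>
  define e where "e = ks ! (n - Suc p)"
  define V where "V js = (\<Prod>s\<in>{Suc p..<n}. C (js ! (2 * s)) (js ! (2 * s + 1)) (ks ! (s - Suc p)))" for js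
  have split: "struct_prod C n js (is @ ks) = struct_prod C (Suc p) js is * V js"
    if "length is = Suc p" for js "is"
  proof -
    have "{..<n} = {..<Suc p} \<union> {Suc p..<n}" using \<open>p < n\<close> by auto
    then show ?thesis
      unfolding struct_prod_def V_def using that
      by (simp add: prod.union_disjoint ivl_disj_int nth_append del: lessThan_Suc)
  qed
  have "(\<Sum>is\<in>idx (Suc p). assoc_tensor C (Suc n) \<Omega> (is @ ks) * k is)
      = (\<Sum>is\<in>idx (Suc p). \<Sum>js\<in>idx N. \<Omega> (js @ [e]) * V js * (struct_prod C (Suc p) js is * k is))"
    using \<open>p < n\<close>
    by (intro sum.cong refl) (simp add: assoc_tensor_def split nth_append N_def e_def sum_distrib_left mult_ac)
  also have "\<dots> = (\<Sum>js\<in>idx N. \<Omega> (js @ [e]) * V js * (\<Sum>is\<in>idx (Suc p). struct_prod C (Suc p) js is * k is))"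
    by (subst sum.swap) (simp add: sum_distrib_left)
  also have "\<dots> = - (\<Sum>r<p. \<Sum>js\<in>idx N. \<Omega> (js @ [e]) * V js * moved_term C p k r js)"
    unfolding struct_prod_contraction[OF k] by (subst sum.swap) (simp add: sum_distrib_left sum_negf)
  also have "\<dots> = 0"
  proof -
    have "(\<Sum>js\<in>idx N. \<Omega> (js @ [e]) * V js * moved_term C p k r js) = 0" if "r < p" for r
    proof (rule sum_moved_term[OF C that])
      show le: "2 * p + 2 \<le> N" using \<open>p < n\<close> by (simp add: N_def)
      fix \<tau> and js :: "'a list" assume \<tau>: "\<tau> permutes {..<2 * p + 2}" and js: "length js = N"
      have \<tau>N: "\<tau> permutes {..<N}" using \<tau> le by (meson lessThan_subset_iff permutes_subset)
      have \<tau>N': "\<tau> permutes {..<N + 1}" using \<tau> le by (intro permutes_subset[OF \<tau>]) simp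
      show "V (permute_list \<tau> js) = V js"
        unfolding V_def
      proof (rule prod.cong[OF refl])
        fix s assume s: "s \<in> {Suc p..<n}"
        then have "\<tau> (2 * s) = 2 * s" "\<tau> (2 * s + 1) = 2 * s + 1"
          by (auto intro!: permutes_not_in[OF \<tau>])
        then show "C (permute_list \<tau> js ! (2 * s)) (permute_list \<tau> js ! (2 * s + 1)) (ks ! (s - Suc p))
          = C (js ! (2 * s)) (js ! (2 * s + 1)) (ks ! (s - Suc p))"
          using s js \<tau>N by (simp add: permute_list_nth N_def)
      qed
      \<comment> \<open>\<open>\<tau>\<close> fixes the final position \<open>N\<close>, so
        permuting \<open>js\<close> amounts to permuting the whole argument of
        \<open>\<Omega>\<close> by the same even permutation.\<close>
      have "permute_list \<tau> js @ [e] = permute_list \<tau> (js @ [e])"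
      proof (rule nth_equalityI)
        fix x assume "x < length (permute_list \<tau> js @ [e])"
        then have "x < N + 1" using js by simp
        moreover have "\<tau> x < N" if "x < N" using permutes_in_image[OF \<tau>N, of x] that by simp
        moreover have "\<tau> N = N" using permutes_not_in[OF \<tau>N] by simp
        ultimately show "(permute_list \<tau> js @ [e]) ! x = permute_list \<tau> (js @ [e]) ! x"
          using js \<tau>N \<tau>N' by (cases "x = N") (simp_all add: nth_append permute_list_nth)
      qed (simp add: js)
      then show "\<Omega> (permute_list \<tau> js @ [e]) = \<Omega> (js @ [e])" if "sign \<tau> = 1"
        using even[of \<tau> "js @ [e]"] \<tau>N' js that by (simp add: N_def)
    qed
    then show ?thesis by simp
  qed
  finally show ?thesis .
qed

theorem lemma3p3:
  fixes br :: "'g::real_vector \<Rightarrow> 'g \<Rightarrow> 'g"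
    and X :: "'n::finite \<Rightarrow> 'g"
    and C :: "'n \<Rightarrow> 'n \<Rightarrow> 'n \<Rightarrow> real"
    and m l :: nat
    and \<Omega>\<^sub>m \<Omega>\<^sub>l t\<^sub>m t\<^sub>l :: "'n tensor"
  assumes "compact_simple_lie_algebra br X"
    and "killing_orthogonal br X"
    and "C = struct_const br X"
    and "1 \<le> l" and "l < m"
    and "primitive_cocycle C m \<Omega>\<^sub>m"
    and "primitive_cocycle C l \<Omega>\<^sub>l"
    and "t\<^sub>m = assoc_tensor C m \<Omega>\<^sub>m"
    and "t\<^sub>l = assoc_tensor C l \<Omega>\<^sub>l"
  shows "\<forall>ks\<in>idx (m - l). (\<Sum>is\<in>idx l. t\<^sub>m (is @ ks) * t\<^sub>l is) = 0"
proof
  fix ks :: "'n list" assume ks: "ks \<in> idx (m - l)"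
  have C: "antisymmetric_jacobi C"
    using antisymmetric_jacobi_struct_const[of br X] assms(1-3)
    by (simp add: compact_simple_lie_algebra_def simple_lie_algebra_def)
  \<comment> \<open>Successor form turns \<open>m - 1\<close>, \<open>2 * m - 2\<close> and
    \<open>2 * m - 1\<close> into \<open>n\<close>, \<open>2 * n\<close> and
    \<open>Suc (2 * n)\<close>, and likewise for \<open>l\<close> and \<open>p\<close>.\<close>
  obtain p n where l: "l = Suc p" and m: "m = Suc n" and "p < n"
    using assms(4,5) by (cases l; cases m) auto
  obtain h where h: "invariant_tensor C (Suc p) h"
    and \<Omega>l: "\<And>is. length is = Suc (2 * p) \<Longrightarrow> \<Omega>\<^sub>l is = cocycle_of C (Suc p) h is"
    using assms(7) unfolding primitive_cocycle_def primitive_tensor_def l by auto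
  obtain g where \<Omega>m: "\<And>is. length is = Suc (2 * n) \<Longrightarrow> \<Omega>\<^sub>m is = cocycle_of C (Suc n) g is"
    using assms(6) unfolding primitive_cocycle_def m by auto
  \<comment> \<open>The cocycles of the two orders enter differently: that of order
    \<open>2 * l - 1\<close> through its invariance, that of order \<open>2 * m - 1\<close> through
    its behaviour under even permutations. Each agrees with \<open>cocycle_of\<close> only on lists
    of the right length, hence the congruence rule.\<close>
  have "invariant_tensor C (Suc (2 * p)) \<Omega>\<^sub>l"
    using invariant_cocycle_of[OF C h] by (subst invariant_tensor_cong[OF \<Omega>l])
  then have "invariant_tensor C (Suc p) t\<^sub>l"
    unfolding assms(9) l by (rule invariant_assoc_tensor[OF C])
  moreover have "\<Omega>\<^sub>m (permute_list \<tau> xs) = \<Omega>\<^sub>m xs"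
    if "\<tau> permutes {..<2 * n + 1}" "sign \<tau> = 1" "length xs = 2 * n + 1" for \<tau> xs
    using that cocycle_of_permute[of \<tau> "Suc n" xs C g] by (simp add: \<Omega>m)
  ultimately show "(\<Sum>is\<in>idx l. t\<^sub>m (is @ ks) * t\<^sub>l is) = 0"
    using assoc_tensor_contraction[OF C _ \<open>p < n\<close>] ks unfolding assms(8) l m by simp
qed

end
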